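(* Let $\{\tilde p_\theta\}_{\theta\in\Theta}$, with $\tilde p_\theta(x)=\exp(\langle\theta,t(x)\rangle)$, be the unnormalized densities of a regular exponential family with natural parameter space $\Theta\subset\mathbb{R}^m$ and partition function $Z(\theta)=\int\tilde p_\theta\,\mathrm{d}\mu$. Then for all $\theta_1,\theta_2\in\Theta$ and all $\alpha\in\mathbb{R}$, the $\alpha$-divergence between the unnormalized densities equals the scaled $\alpha$-skewed Jensen divergence induced by the partition function between the natural parameters: $$D_\alpha(\tilde p_{\theta_1}:\tilde p_{\theta_2})=J^s_{Z,\alpha}(\theta_1:\theta_2).$$ In particular, in the cases $\alpha\in\{0,1\}$, the oriented (extended) Kullback–Leibler divergences between unnormalized densities amount to Bregman divergences for $Z$ with swapped parameter order: $$D_{\mathrm{KL}}(\tilde p_{\theta_1}:\tilde p_{\theta_2})=B_Z(\theta_2:\theta_1)\quad\text{for all }\theta_1,\theta_2\in\Theta.$$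
   Context: Exponential family: $(\mathcal{X},\mathcal{A},\mu)$ is a measure space with $\mu$ a positive measure, $t:\mathcal{X}\to\mathbb{R}^m$ is a measurable sufficient statistic, and $\langle\cdot,\cdot\rangle$ is an inner product on $\mathbb{R}^m$ (gradients are taken with respect to it). The auxiliary carrier term is taken to be $1$, so the unnormalized densities with respect to $\mu$ are $\tilde p_\theta(x)=\exp(\langle\theta,t(x)\rangle)$. The partition function is $Z(\theta)=\int\tilde p_\theta\,\mathrm{d}\mu$, and the natural parameter space is $\Theta=\{\theta\in\mathbb{R}^m : Z(\theta)<\infty\}$, which is assumed nonempty. The family is regular if $\Theta$ is open. ($\Theta$ is always convex, and $Z$ is smooth on $\Theta$ in the regular case.) For $\theta\in\mathbb{R}^m\setminus\Theta$, $Z(\theta)=+\infty$. Extended Kullback–Leibler divergence between positive (not necessarily normalized) densities $\tilde p,\tilde q$: $$D_{\mathrm{KL}}(\tilde p:\tilde q)=\int\left(\tilde p\log\frac{\tilde p}{\tilde q}+\tilde q-\tilde p\right)\mathrm{d}\mu .$$ $\alpha$-divergences between positive densities: $$D_\alpha(\tilde p:\tilde q)=\begin{cases}\frac{1}{\alpha(1-\alpha)}\int\left(\alpha\tilde p+(1-\alpha)\tilde q-\tilde p^{\alpha}\tilde q^{1-\alpha}\right)\mathrm{d}\mu, & \alpha\in\mathbb{R}\setminus\{0,1\},\\ D_{\mathrm{KL}}(\tilde q:\tilde p), & \alpha=0,\\ D_{\mathrm{KL}}(\tilde p:\tilde q), & \alpha=1.\end{cases}$$ Bregman divergence induced by $Z$: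 $B_Z(\theta_1:\theta_2)=Z(\theta_1)-Z(\theta_2)-\langle\theta_1-\theta_2,\nabla Z(\theta_2)\rangle$ for $\theta_1,\theta_2\in\Theta$. $\alpha$-skewed Jensen divergence induced by $Z$: $J_{Z,\alpha}(\theta_1:\theta_2)=\alpha Z(\theta_1)+(1-\alpha)Z(\theta_2)-Z(\alpha\theta_1+(1-\alpha)\theta_2)$. Scaled $\alpha$-skewed Jensen divergence: $$J^s_{Z,\alpha}(\theta_1:\theta_2)=\begin{cases}\frac{1}{\alpha(1-\alpha)}J_{Z,\alpha}(\theta_1:\theta_2), & \alpha\in\mathbb{R}\setminus\{0,1\},\\ B_Z(\theta_1:\theta_2), & \alpha=0,\\ B_Z(\theta_2:\theta_1), & \alpha=1.\end{cases}$$ When $\alpha\notin[0,1]$ and $\alpha\theta_1+(1-\alpha)\theta_2\notin\Theta$, the identity is understood in the extended reals (both sides being computed with the convention $Z=+\infty$ outside $\Theta$). *)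

theory Defs
  imports "HOL-Analysis.Analysis"
begin

text \<open>An arbitrary inner product on \<open>real ^ 'm\<close>, not necessarily the Euclidean one.\<close>

definition is_inner_product :: "(real ^ 'm \<Rightarrow> real ^ 'm \<Rightarrow> real) \<Rightarrow> bool" where
  "is_inner_product ip \<longleftrightarrow>
     bilinear ip \<and> (\<forall>x y. ip x y = ip y x) \<and> (\<forall>x. x \<noteq> 0 \<longrightarrow> 0 < ip x x)"

text \<open>The gradient with respect to \<open>ip\<close>: the vector representing the Frechet derivative
  through \<open>ip\<close>. It is unspecified where \<open>f\<close> is not differentiable.\<close>

definition gradient ::
    "(real ^ 'm \<Rightarrow> real ^ 'm \<Rightarrow> real) \<Rightarrow> (real ^ 'm \<Rightarrow> real) \<Rightarrow> real ^ 'm \<Rightarrow> real ^ 'm" where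
  "gradient ip f x = (THE g. (f has_derivative (\<lambda>h. ip g h)) (at x))"

lemma gradient_eq:
  assumes ip: "is_inner_product ip" and g: "(f has_derivative (\<lambda>h. ip g h)) (at x)"
  shows "gradient ip f x = g"
  unfolding gradient_def
proof (rule the_equality)
  fix g' assume "(f has_derivative (\<lambda>h. ip g' h)) (at x)"
  then have "ip g' = ip g"
    using g by (metis has_derivative_unique)
  moreover have "ip (g' - g) (g' - g) = ip g' (g' - g) - ip g (g' - g)"
    using ip by (simp add: is_inner_product_def bilinear_lsub)
  ultimately have "ip (g' - g) (g' - g) = 0"
    by simp
  then show "g' = g"
    using ip unfolding is_inner_product_def by (metis eq_iff_diff_eq_0 less_irrefl)
qed (fact g)

text \<open>The Lebesgue integral with values in the extended reals, as the integral of the positive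
  part minus that of the negative part. It is meaningful when at least one of the two is finite
  (on \<open>ereal\<close>, \<open>\<infinity> - \<infinity> = \<infinity>\<close>); for the divergences of positive densities below the integrand
  has constant sign.\<close>

definition ext_integral :: "'x measure \<Rightarrow> ('x \<Rightarrow> real) \<Rightarrow> ereal" where
  "ext_integral M f =
     enn2ereal (\<integral>\<^sup>+x. ennreal (f x) \<partial>M) - enn2ereal (\<integral>\<^sup>+x. ennreal (- f x) \<partial>M)"

lemma ext_integral_eq_integral:
  assumes "integrable M f"
  shows "ext_integral M f = ereal (integral\<^sup>L M f)"
proof -
  obtain r q where "0 \<le> r" "0 \<le> q"
    and "(\<integral>\<^sup>+x. ennreal (f x) \<partial>M) = ennreal r" "(\<integral>\<^sup>+x. ennreal (- f x) \<partial>M) = ennreal q"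
    and "integral\<^sup>L M f = r - q"
    using assms by (rule integrableE)
  then show ?thesis
    by (simp add: ext_integral_def)
qed

definition unnormalized_density ::
    "(real ^ 'm \<Rightarrow> real ^ 'm \<Rightarrow> real) \<Rightarrow> ('x \<Rightarrow> real ^ 'm) \<Rightarrow> real ^ 'm \<Rightarrow> 'x \<Rightarrow> real" where
  "unnormalized_density ip t \<theta> x = exp (ip \<theta> (t x))"

definition partition_function ::
    "'x measure \<Rightarrow> (real ^ 'm \<Rightarrow> real ^ 'm \<Rightarrow> real) \<Rightarrow> ('x \<Rightarrow> real ^ 'm) \<Rightarrow> real ^ 'm \<Rightarrow> ereal" where
  "partition_function M ip t \<theta> =
     enn2ereal (\<integral>\<^sup>+x. ennreal (unnormalized_density ip t \<theta> x) \<partial>M)"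

definition natural_parameter_space ::
    "'x measure \<Rightarrow> (real ^ 'm \<Rightarrow> real ^ 'm \<Rightarrow> real) \<Rightarrow> ('x \<Rightarrow> real ^ 'm) \<Rightarrow> (real ^ 'm) set" where
  "natural_parameter_space M ip t = {\<theta>. partition_function M ip t \<theta> < \<infinity>}"

text \<open>Sufficiency of \<open>t\<close> is not a separate condition: the densities depend on \<open>x\<close> only
  through \<open>t x\<close>.\<close>

definition regular_exponential_family ::
    "'x measure \<Rightarrow> (real ^ 'm \<Rightarrow> real ^ 'm \<Rightarrow> real) \<Rightarrow> ('x \<Rightarrow> real ^ 'm) \<Rightarrow> bool" where
  "regular_exponential_family M ip t \<longleftrightarrow>
     is_inner_product ip \<and> t \<in> borel_measurable M \<and>
     natural_parameter_space M ip t \<noteq> {} \<and> open (natural_parameter_space M ip t)"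

definition KL_div :: "'x measure \<Rightarrow> ('x \<Rightarrow> real) \<Rightarrow> ('x \<Rightarrow> real) \<Rightarrow> ereal" where
  "KL_div M p q = ext_integral M (\<lambda>x. p x * ln (p x / q x) + q x - p x)"

definition alpha_div :: "'x measure \<Rightarrow> real \<Rightarrow> ('x \<Rightarrow> real) \<Rightarrow> ('x \<Rightarrow> real) \<Rightarrow> ereal" where
  "alpha_div M \<alpha> p q =
     (if \<alpha> = 0 then KL_div M q p
      else if \<alpha> = 1 then KL_div M p q
      else ereal (1 / (\<alpha> * (1 - \<alpha>))) *
        ext_integral M (\<lambda>x. \<alpha> * p x + (1 - \<alpha>) * q x - p x powr \<alpha> * q x powr (1 - \<alpha>)))"

text \<open>The generator \<open>F\<close> is extended-real-valued, so that it can be \<open>\<infinity>\<close> outside its effective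
  domain; the gradient is that of its real-valued restriction to the domain.\<close>

definition bregman_div ::
    "(real ^ 'm \<Rightarrow> real ^ 'm \<Rightarrow> real) \<Rightarrow> (real ^ 'm \<Rightarrow> ereal) \<Rightarrow> real ^ 'm \<Rightarrow> real ^ 'm \<Rightarrow> ereal" where
  "bregman_div ip F \<theta>1 \<theta>2 =
     F \<theta>1 - F \<theta>2 - ereal (ip (\<theta>1 - \<theta>2) (gradient ip (\<lambda>\<theta>. real_of_ereal (F \<theta>)) \<theta>2))"

definition skew_jensen_div ::
    "(real ^ 'm \<Rightarrow> ereal) \<Rightarrow> real \<Rightarrow> real ^ 'm \<Rightarrow> real ^ 'm \<Rightarrow> ereal" where
  "skew_jensen_div F \<alpha> \<theta>1 \<theta>2 =
     ereal \<alpha> * F \<theta>1 + ereal (1 - \<alpha>) * F \<theta>2 - F (\<alpha> *\<^sub>R \<theta>1 + (1 - \<alpha>) *\<^sub>R \<theta>2)"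

definition scaled_skew_jensen_div ::
    "(real ^ 'm \<Rightarrow> real ^ 'm \<Rightarrow> real) \<Rightarrow> (real ^ 'm \<Rightarrow> ereal) \<Rightarrow> real \<Rightarrow> real ^ 'm \<Rightarrow> real ^ 'm \<Rightarrow> ereal"
  where
  "scaled_skew_jensen_div ip F \<alpha> \<theta>1 \<theta>2 =
     (if \<alpha> = 0 then bregman_div ip F \<theta>1 \<theta>2
      else if \<alpha> = 1 then bregman_div ip F \<theta>2 \<theta>1
      else ereal (1 / (\<alpha> * (1 - \<alpha>))) * skew_jensen_div F \<alpha> \<theta>1 \<theta>2)"

end

theory Submission
  imports Defs
begin

text \<open>Since \<open>p\<^sub>1 powr \<alpha> * p\<^sub>2 powr (1 - \<alpha>)\<close> is again the density of the family with parameter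
  \<open>\<alpha> \<theta>\<^sub>1 + (1 - \<alpha>) \<theta>\<^sub>2\<close>, the case \<open>\<alpha> \<notin> {0, 1}\<close> is linearity of the integral, with value
  \<open>- \<infinity>\<close> (before scaling) on both sides when the mixed parameter leaves the natural parameter
  space. For \<open>\<alpha> \<in> {0, 1}\<close> the logarithm of the quotient of the densities is
  \<open>ip (\<theta>\<^sub>1 - \<theta>\<^sub>2) t\<close>, and one differentiates the partition function under the integral sign: in
  the interior of the parameter space the density times \<open>exp (d * norm t)\<close> is integrable for some
  \<open>d > 0\<close>, and this dominates the second-order remainder of the exponential.\<close>

section \<open>Exponential bounds\<close>

text \<open>The Lagrange remainder is \<open>exp s * y\<^sup>2 / 2\<close> with
  \<open>\<bar>s\<bar> \<le> \<bar>y\<bar> \<le> w\<close>. Splitting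
  \<open>y\<^sup>2 \<le> l\<^sup>2 * w\<^sup>2\<close> keeps the small factor
  \<open>l\<^sup>2\<close> outside, while \<open>w\<^sup>2 / 2\<close> is absorbed into a second
  factor \<open>exp w\<close>.\<close>

lemma exp_remainder_le:
  fixes y :: real
  assumes "\<bar>y\<bar> \<le> l * w" "0 \<le> l" "l \<le> 1" "0 \<le> w"
  shows "\<bar>exp y - 1 - y\<bar> \<le> l\<^sup>2 * exp (2 * w)"
proof -
  obtain s where s: "\<bar>s\<bar> \<le> \<bar>y\<bar>" "exp y = (\<Sum>m<2. y ^ m / fact m) + exp s / fact 2 * y ^ 2"
    using Maclaurin_exp_le by blast
  have "l * w \<le> w"
    using assms by (simp add: mult_left_le_one_le)
  then have "exp s \<le> exp w"
    using s(1) assms(1) by simp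
  moreover have "w\<^sup>2 / 2 \<le> exp w"
    using exp_lower_Taylor_quadratic[OF assms(4)] assms(4) by linarith
  moreover have "y\<^sup>2 \<le> (l * w)\<^sup>2"
    using assms(1) by (metis abs_ge_zero power2_abs power_mono)
  ultimately have "exp s * y\<^sup>2 / 2 \<le> exp w * (l * w)\<^sup>2 / 2"
    by (intro divide_right_mono mult_mono) auto
  also have "\<dots> = l\<^sup>2 * (exp w * (w\<^sup>2 / 2))"
    by (simp add: power_mult_distrib)
  also have "\<dots> \<le> l\<^sup>2 * (exp w * exp w)"
    using \<open>w\<^sup>2 / 2 \<le> exp w\<close> by (intro mult_left_mono) auto
  finally show ?thesis
    using s(2) by (simp add: numeral_2_eq_2 flip: exp_add)
qed

text \<open>If \<open>b\<close> carries the largest coordinate in absolute value, then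
  \<open>norm x\<close> is at most the dimension times \<open>\<bar>b \<bullet> x\<bar>\<close>, and
  the exponential of an absolute value is at most the sum of the exponentials for both signs.
  Summing over the whole basis makes the bound independent of \<open>b\<close>, so that only
  exponentials of linear functionals of \<open>x\<close> remain.\<close>

lemma exp_norm_le_sum_Basis:
  fixes x :: "'a::euclidean_space"
  assumes "0 \<le> c"
  shows "exp (c * norm x)
    \<le> (\<Sum>b\<in>Basis. exp ((c * DIM('a)) * (b \<bullet> x)) + exp (- (c * DIM('a)) * (b \<bullet> x)))"
proof -
  define m where "m = Max ((\<lambda>b. \<bar>x \<bullet> b\<bar>) ` (Basis :: 'a set))"
  have "m \<in> (\<lambda>b. \<bar>x \<bullet> b\<bar>) ` (Basis :: 'a set)"
    unfolding m_def by (intro Max_in) auto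
  then obtain b :: 'a where b: "b \<in> Basis" "m = \<bar>x \<bullet> b\<bar>"
    by blast
  have "norm x \<le> (\<Sum>b\<in>Basis. \<bar>x \<bullet> b\<bar>)"
    by (rule norm_le_l1)
  also have "\<dots> \<le> (\<Sum>b\<in>(Basis :: 'a set). m)"
    by (intro sum_mono) (simp add: m_def)
  finally have "norm x \<le> DIM('a) * \<bar>b \<bullet> x\<bar>"
    by (simp add: b inner_commute)
  then have "exp (c * norm x) \<le> exp (c * (DIM('a) * \<bar>b \<bullet> x\<bar>))"
    using assms by (simp add: mult_left_mono)
  also have "\<dots> \<le> exp ((c * DIM('a)) * (b \<bullet> x)) + exp (- (c * DIM('a)) * (b \<bullet> x))"
    by (cases "0 \<le> b \<bullet> x") (auto simp: algebra_simps)
  also have "\<dots> \<le> (\<Sum>b\<in>Basis. exp ((c * DIM('a)) * (b \<bullet> x)) + exp (- (c * DIM('a)) * (b \<bullet> x)))"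
    using b(1) by (intro member_le_sum) (auto intro: add_nonneg_nonneg)
  finally show ?thesis .
qed

section \<open>Differentiation under the integral sign\<close>

text \<open>Multiplied by \<open>exp (\<theta> \<bullet> T x)\<close>, each term of the
  coordinatewise bound becomes the exponential for a parameter
  \<open>\<theta> \<plusminus> e *\<^sub>R b\<close>, which lies in a closed ball of integrable
  parameters.\<close>

lemma integrable_exp_inner_mult_exp_norm:
  fixes T :: "'x \<Rightarrow> 'a::euclidean_space"
  assumes [measurable]: "T \<in> borel_measurable M"
    and int: "\<theta> \<in> interior {\<theta>. integrable M (\<lambda>x. exp (\<theta> \<bullet> T x))}"
  obtains d where "0 < d" "integrable M (\<lambda>x. exp (\<theta> \<bullet> T x) * exp (d * norm (T x)))"
proof -
  obtain e where e: "0 < e" "cball \<theta> e \<subseteq> {\<theta>. integrable M (\<lambda>x. exp (\<theta> \<bullet> T x))}"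
    using int by (auto simp: mem_interior_cball)
  \<comment> \<open>The dimension factor of the coordinatewise bound then turns \<open>d\<close>
    into exactly the radius \<open>e\<close>.\<close>
  define d where "d = e / DIM('a)"
  have d: "0 < d" and dim: "d * DIM('a) = e"
    using e by (simp_all add: d_def)
  have i: "integrable M (\<lambda>x. exp (\<theta> \<bullet> T x + r * (b \<bullet> T x)))" if "b \<in> Basis" "\<bar>r\<bar> = e" for b r
  proof -
    have "\<theta> + r *\<^sub>R b \<in> cball \<theta> e"
      using that by (simp add: dist_norm)
    then show ?thesis
      using e(2) by (auto simp: inner_add_left)
  qed
  have "integrable M (\<lambda>x. \<Sum>b\<in>Basis.
      exp (\<theta> \<bullet> T x + e * (b \<bullet> T x)) + exp (\<theta> \<bullet> T x + (- e) * (b \<bullet> T x)))"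
    using e by (intro Bochner_Integration.integrable_sum Bochner_Integration.integrable_add i) auto
  then have "integrable M (\<lambda>x. exp (\<theta> \<bullet> T x) * exp (d * norm (T x)))"
  proof (rule Bochner_Integration.integrable_bound)
    have "exp (\<theta> \<bullet> T x) * exp (d * norm (T x)) \<le> (\<Sum>b\<in>Basis.
        exp (\<theta> \<bullet> T x + e * (b \<bullet> T x)) + exp (\<theta> \<bullet> T x + (- e) * (b \<bullet> T x)))" for x
      using mult_left_mono[OF exp_norm_le_sum_Basis[of d "T x"], of "exp (\<theta> \<bullet> T x)"] d
      by (simp only: dim exp_add sum_distrib_left distrib_left) simp
    then show "AE x in M. norm (exp (\<theta> \<bullet> T x) * exp (d * norm (T x)))
        \<le> norm (\<Sum>b\<in>Basis.
          exp (\<theta> \<bullet> T x + e * (b \<bullet> T x)) + exp (\<theta> \<bullet> T x + (- e) * (b \<bullet> T x)))"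
      by (auto intro: order_trans[OF _ abs_ge_self])
  qed measurable
  with d show ?thesis ..
qed

text \<open>A single integrable function, the exponential at \<open>\<theta>\<close> times
  \<open>exp (d * norm (T x))\<close>, dominates the nearby exponentials, the integrand of the
  derivative and the second-order remainder. Integrating the remainder gives an error quadratic in
  \<open>norm h\<close>.\<close>

lemma
  fixes T :: "'x \<Rightarrow> 'a::euclidean_space"
  assumes [measurable]: "T \<in> borel_measurable M"
    and int: "\<theta> \<in> interior {\<theta>. integrable M (\<lambda>x. exp (\<theta> \<bullet> T x))}"
  shows integrable_exp_inner_scaleR: "integrable M (\<lambda>x. exp (\<theta> \<bullet> T x) *\<^sub>R T x)"
    and has_derivative_integral_exp_inner:
      "((\<lambda>\<theta>. \<integral>x. exp (\<theta> \<bullet> T x) \<partial>M) has_derivative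
        (\<lambda>h. h \<bullet> (\<integral>x. exp (\<theta> \<bullet> T x) *\<^sub>R T x \<partial>M))) (at \<theta>)"
proof -
  obtain d where d: "0 < d"
    and dom: "integrable M (\<lambda>x. exp (\<theta> \<bullet> T x) * exp (d * norm (T x)))"
    using integrable_exp_inner_mult_exp_norm[OF assms] .
  have exp_int: "integrable M (\<lambda>x. exp ((\<theta> + h) \<bullet> T x))" if "norm h \<le> d" for h
  proof (rule Bochner_Integration.integrable_bound[OF dom])
    have "h \<bullet> T x \<le> d * norm (T x)" for x
      using norm_cauchy_schwarz[of h "T x"] mult_right_mono[OF that, of "norm (T x)"] by simp
    then show "AE x in M. norm (exp ((\<theta> + h) \<bullet> T x))
        \<le> norm (exp (\<theta> \<bullet> T x) * exp (d * norm (T x)))"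
      by (simp add: inner_add_left flip: exp_add)
  qed measurable
  show T_int: "integrable M (\<lambda>x. exp (\<theta> \<bullet> T x) *\<^sub>R T x)"
  proof (rule Bochner_Integration.integrable_bound)
    show "integrable M (\<lambda>x. exp (\<theta> \<bullet> T x) * exp (d * norm (T x)) / d)"
      using dom by simp
    \<comment> \<open>The linear growth of \<open>T\<close> is absorbed into the exponential, at the
      price of the factor \<open>1 / d\<close>.\<close>
    have "d * norm (T x) \<le> exp (d * norm (T x))" for x
      using exp_ge_add_one_self[of "d * norm (T x)"] by linarith
    then have "norm (T x) \<le> exp (d * norm (T x)) / d" for x
      using d by (simp add: field_simps)
    then show "AE x in M. norm (exp (\<theta> \<bullet> T x) *\<^sub>R T x)
        \<le> norm (exp (\<theta> \<bullet> T x) * exp (d * norm (T x)) / d)"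
      using d by (simp flip: times_divide_eq_right)
  qed measurable
  define G where "G = (\<integral>x. exp (\<theta> \<bullet> T x) *\<^sub>R T x \<partial>M)"
  define K where "K = (\<integral>x. exp (\<theta> \<bullet> T x) * exp (d * norm (T x)) \<partial>M)"
  define Z where "Z = (\<lambda>\<theta>. \<integral>x. exp (\<theta> \<bullet> T x) \<partial>M)"
  \<comment> \<open>The restriction to \<open>d / 2\<close> ensures
    \<open>2 * norm h / d \<le> 1\<close>, the condition on \<open>l\<close> in the remainder
    estimate.\<close>
  have bound: "\<bar>Z (\<theta> + h) - Z \<theta> - h \<bullet> G\<bar> \<le> (2 * norm h / d)\<^sup>2 * K" if h: "norm h \<le> d / 2" for h
  proof -
    have i: "integrable M (\<lambda>x. exp ((\<theta> + h) \<bullet> T x))" "integrable M (\<lambda>x. exp (\<theta> \<bullet> T x))"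
      "integrable M (\<lambda>x. h \<bullet> (exp (\<theta> \<bullet> T x) *\<^sub>R T x))"
      using exp_int[of h] exp_int[of 0] h d integrable_inner_right[OF T_int] by simp_all
    have "h \<bullet> G = (\<integral>x. h \<bullet> (exp (\<theta> \<bullet> T x) *\<^sub>R T x) \<partial>M)"
      unfolding G_def by (rule integral_inner_right[symmetric]) (rule T_int)
    then have "Z (\<theta> + h) - Z \<theta> - h \<bullet> G
        = (\<integral>x. exp ((\<theta> + h) \<bullet> T x) - exp (\<theta> \<bullet> T x) - h \<bullet> (exp (\<theta> \<bullet> T x) *\<^sub>R T x) \<partial>M)"
      unfolding Z_def using i by simp
    also have "norm \<dots> \<le> (\<integral>x. (2 * norm h / d)\<^sup>2 * (exp (\<theta> \<bullet> T x) * exp (d * norm (T x))) \<partial>M)"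
    proof (rule order_trans[OF Bochner_Integration.integral_norm_bound Bochner_Integration.integral_mono])
      fix x
      \<comment> \<open>Here \<open>l = 2 * norm h / d\<close> and
        \<open>w = d * norm (T x) / 2\<close>: their product is the Cauchy-Schwarz bound for
        \<open>h \<bullet> T x\<close>, and \<open>exp (2 * w)\<close> is the factor in the
        dominating function.\<close>
      have "\<bar>exp (h \<bullet> T x) - 1 - h \<bullet> T x\<bar>
          \<le> (2 * norm h / d)\<^sup>2 * exp (2 * (d * norm (T x) / 2))"
        using h d Cauchy_Schwarz_ineq2[of h "T x"]
        by (intro exp_remainder_le) (auto simp: field_simps)
      then have "exp (\<theta> \<bullet> T x) * \<bar>exp (h \<bullet> T x) - 1 - h \<bullet> T x\<bar>
          \<le> exp (\<theta> \<bullet> T x) * ((2 * norm h / d)\<^sup>2 * exp (d * norm (T x)))"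
        by (intro mult_left_mono) auto
      moreover have "exp ((\<theta> + h) \<bullet> T x) - exp (\<theta> \<bullet> T x) - h \<bullet> (exp (\<theta> \<bullet> T x) *\<^sub>R T x)
          = exp (\<theta> \<bullet> T x) * (exp (h \<bullet> T x) - 1 - h \<bullet> T x)"
        by (simp add: inner_add_left exp_add right_diff_distrib)
      ultimately show "norm (exp ((\<theta> + h) \<bullet> T x) - exp (\<theta> \<bullet> T x) - h \<bullet> (exp (\<theta> \<bullet> T x) *\<^sub>R T x))
          \<le> (2 * norm h / d)\<^sup>2 * (exp (\<theta> \<bullet> T x) * exp (d * norm (T x)))"
        by (simp add: abs_mult mult_ac)
    qed (use i dom in auto)
    finally show ?thesis
      by (simp add: K_def)
  qed
  have "(Z has_derivative (\<lambda>h. h \<bullet> G)) (at \<theta>)"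
  proof (rule has_derivativeI_sandwich)
    show "0 < d / 2"
      using d by simp
    show "bounded_linear (\<lambda>h. h \<bullet> G)"
      by (rule bounded_linear_inner_left)
    fix y assume y: "y \<noteq> \<theta>" "dist y \<theta> < d / 2"
    have "\<bar>Z y - Z \<theta> - (y - \<theta>) \<bullet> G\<bar> \<le> (2 * norm (y - \<theta>) / d)\<^sup>2 * K"
      using bound[of "y - \<theta>"] y by (simp add: dist_norm)
    then show "norm (Z y - Z \<theta> - (y - \<theta>) \<bullet> G) / norm (y - \<theta>) \<le> (2 / d)\<^sup>2 * norm (y - \<theta>) * K"
      using y by (simp add: field_simps power2_eq_square)
  next
    show "((\<lambda>y. (2 / d)\<^sup>2 * norm (y - \<theta>) * K) \<longlongrightarrow> 0) (at \<theta>)"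
      by (auto intro!: tendsto_eq_intros)
  qed
  then show "((\<lambda>\<theta>. \<integral>x. exp (\<theta> \<bullet> T x) \<partial>M) has_derivative
        (\<lambda>h. h \<bullet> (\<integral>x. exp (\<theta> \<bullet> T x) *\<^sub>R T x \<partial>M))) (at \<theta>)"
    by (simp add: Z_def G_def)
qed

section \<open>General inner products and infinite integrals\<close>

text \<open>\<open>A\<close> is the Gram map of \<open>ip\<close> in the standard basis. Positive
  definiteness makes it injective, hence surjective in finite dimension. It reduces
  \<open>ip\<close> to the Euclidean product, and surjectivity provides gradients with respect to
  \<open>ip\<close>.\<close>

lemma is_inner_product_eq_inner:
  assumes "is_inner_product ip"
  obtains A where "linear A" "surj A" "\<And>x y. ip x y = x \<bullet> A y"
proof -
  have ip: "bilinear ip" "\<And>x y. ip x y = ip y x" "\<And>x. x \<noteq> 0 \<Longrightarrow> 0 < ip x x"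
    using assms by (auto simp: is_inner_product_def)
  have l: "linear (\<lambda>x. ip x y)" "linear (ip x)" for x y
    using ip(1) by (auto simp: bilinear_def)
  define A where "A y = (\<Sum>b\<in>Basis. ip b y *\<^sub>R b)" for y
  have lin: "linear A"
    by (rule linearI)
      (simp_all add: A_def linear_add[OF l(2)] linear_scale[OF l(2)] scaleR_add_left sum.distrib
        scaleR_sum_right)
  have eq: "ip x y = x \<bullet> A y" for x y
  proof -
    have "ip x y = ip (\<Sum>b\<in>Basis. (x \<bullet> b) *\<^sub>R b) y"
      by (simp add: euclidean_representation)
    also have "\<dots> = (\<Sum>b\<in>Basis. (x \<bullet> b) * ip b y)"
      by (simp add: linear_sum[OF l(1)] linear_scale[OF l(1)])
    also have "\<dots> = x \<bullet> A y"
      by (simp add: A_def inner_sum_right mult.commute)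
    finally show ?thesis .
  qed
  have "inj A"
    unfolding linear_injective_0[OF lin] using eq ip(3) by (metis inner_zero_right less_irrefl)
  then have "surj A"
    using lin linear_injective_imp_surjective by blast
  with lin eq show ?thesis
    using that by blast
qed

text \<open>The positive part of \<open>f - g\<close> is at most \<open>\<bar>f\<bar>\<close>, so
  its integral is finite. Since \<open>g\<close> is at most the negative part plus
  \<open>\<bar>f\<bar>\<close>, the negative part must have infinite integral.\<close>

lemma ext_integral_diff_eq_MInf:
  fixes f g :: "'x \<Rightarrow> real"
  assumes f: "integrable M f" and g: "\<And>x. 0 \<le> g x" "(\<integral>\<^sup>+x. ennreal (g x) \<partial>M) = \<infinity>"
    and [measurable]: "g \<in> borel_measurable M"
  shows "ext_integral M (\<lambda>x. f x - g x) = - \<infinity>"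
proof -
  have [measurable]: "f \<in> borel_measurable M"
    using f by auto
  have fin: "(\<integral>\<^sup>+x. ennreal \<bar>f x\<bar> \<partial>M) < \<infinity>"
    using f by (simp add: integrable_iff_bounded)
  have "(\<integral>\<^sup>+x. ennreal (f x - g x) \<partial>M) \<le> (\<integral>\<^sup>+x. ennreal \<bar>f x\<bar> \<partial>M)"
    using g(1) by (intro nn_integral_mono ennreal_leI) (smt (verit))
  with fin have pos: "(\<integral>\<^sup>+x. ennreal (f x - g x) \<partial>M) < \<infinity>"
    by (rule order_le_less_trans[rotated])
  have "(\<integral>\<^sup>+x. ennreal (g x) \<partial>M) \<le> (\<integral>\<^sup>+x. ennreal (- (f x - g x)) + ennreal \<bar>f x\<bar> \<partial>M)"
  proof (intro nn_integral_mono)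
    fix x
    \<comment> \<open>The maximum with \<open>0\<close> makes explicit the truncation that
      \<open>ennreal\<close> performs on negative reals, so that additivity applies.\<close>
    have "ennreal (g x) \<le> ennreal (max 0 (- (f x - g x)) + \<bar>f x\<bar>)"
      by (intro ennreal_leI) linarith
    also have "\<dots> = ennreal (- (f x - g x)) + ennreal \<bar>f x\<bar>"
      by (subst ennreal_plus) (auto simp: max_def ennreal_neg)
    finally show "ennreal (g x) \<le> ennreal (- (f x - g x)) + ennreal \<bar>f x\<bar>" .
  qed
  also have "\<dots> = (\<integral>\<^sup>+x. ennreal (- (f x - g x)) \<partial>M) + (\<integral>\<^sup>+x. ennreal \<bar>f x\<bar> \<partial>M)"
    by (rule nn_integral_add) auto
  finally have "(\<integral>\<^sup>+x. ennreal (- (f x - g x)) \<partial>M) = \<infinity>"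
    using fin g(2) by (auto simp: top_unique)
  moreover obtain r where "0 \<le> r" "(\<integral>\<^sup>+x. ennreal (f x - g x) \<partial>M) = ennreal r"
    using pos by (cases "\<integral>\<^sup>+x. ennreal (f x - g x) \<partial>M") auto
  ultimately show ?thesis
    by (simp add: ext_integral_def)
qed

section \<open>The exponential family and its partition function\<close>

locale regular_family =
  fixes M :: "'x measure"
    and ip :: "real ^ 'm \<Rightarrow> real ^ 'm \<Rightarrow> real"
    and t :: "'x \<Rightarrow> real ^ 'm"
  assumes regular: "regular_exponential_family M ip t"
begin

abbreviation "p \<equiv> unnormalized_density ip t"
abbreviation "Z \<equiv> partition_function M ip t"
abbreviation "\<Theta> \<equiv> natural_parameter_space M ip t"

lemma is_inner_product: "is_inner_product ip"
  and t_measurable [measurable]: "t \<in> borel_measurable M"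
  and open_natural_parameter_space: "open \<Theta>"
  using regular by (auto simp: regular_exponential_family_def)

lemma ip_linear: "linear (\<lambda>x. ip x y)" "linear (ip x)"
  using is_inner_product by (auto simp: is_inner_product_def bilinear_def)

lemma density_pos: "0 < p \<theta> x"
  by (simp add: unnormalized_density_def)

lemma density_measurable [measurable]: "p \<theta> \<in> borel_measurable M"
proof -
  have "ip \<theta> \<in> borel_measurable borel"
    using linear_continuous_on[OF ip_linear(2)[unfolded linear_conv_bounded_linear]]
    by (rule borel_measurable_continuous_onI)
  then show ?thesis
    unfolding unnormalized_density_def by measurable
qed

lemma mem_natural_parameter_space_iff: "\<theta> \<in> \<Theta> \<longleftrightarrow> integrable M (p \<theta>)"
proof -
  have "\<theta> \<in> \<Theta> \<longleftrightarrow> (\<integral>\<^sup>+x. ennreal (p \<theta> x) \<partial>M) < \<infinity>"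
    unfolding natural_parameter_space_def partition_function_def
    by (cases "\<integral>\<^sup>+x. ennreal (p \<theta> x) \<partial>M") auto
  also have "\<dots> \<longleftrightarrow> integrable M (p \<theta>)"
    using less_imp_le[OF density_pos] by (simp add: integrable_iff_bounded)
  finally show ?thesis .
qed

text \<open>Outside \<open>\<Theta>\<close> both sides take the default value \<open>0\<close>. The
  equality of functions on the whole space lets the gradient of \<open>Z\<close> be computed from
  the derivative of the Bochner integral.\<close>

lemma real_of_partition_function: "real_of_ereal (Z \<theta>) = (\<integral>x. p \<theta> x \<partial>M)"
proof -
  have "(\<integral>x. p \<theta> x \<partial>M) = enn2real (\<integral>\<^sup>+x. ennreal (p \<theta> x) \<partial>M)"
    using less_imp_le[OF density_pos] by (intro integral_eq_nn_integral) auto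
  then show ?thesis
    by (simp only: partition_function_def enn2real_def)
qed

lemma partition_function_eq:
  assumes "\<theta> \<in> \<Theta>"
  shows "Z \<theta> = ereal (\<integral>x. p \<theta> x \<partial>M)"
proof -
  have "\<bar>Z \<theta>\<bar> \<noteq> \<infinity>"
    using assms by (auto simp: natural_parameter_space_def partition_function_def)
  then show ?thesis
    using real_of_partition_function by (metis ereal_real')
qed

lemma partition_function_eq_PInf:
  assumes "\<theta> \<notin> \<Theta>"
  shows "Z \<theta> = \<infinity>" "(\<integral>\<^sup>+x. ennreal (p \<theta> x) \<partial>M) = \<infinity>"
  using assms unfolding natural_parameter_space_def partition_function_def
  by (cases "\<integral>\<^sup>+x. ennreal (p \<theta> x) \<partial>M"; simp)+

text \<open>With the statistic \<open>T = A o t\<close> the densities become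
  \<open>exp (\<theta> \<bullet> T x)\<close>, and openness of \<open>\<Theta>\<close> makes
  \<open>\<theta>\<close> an interior point, so the Euclidean differentiation result
  applies.\<close>

lemma
  assumes "\<theta> \<in> \<Theta>"
  shows integrable_ip_density: "integrable M (\<lambda>x. p \<theta> x * ip h (t x))"
    and ip_gradient_partition_function:
      "ip h (gradient ip (\<lambda>\<theta>. real_of_ereal (Z \<theta>)) \<theta>) = (\<integral>x. p \<theta> x * ip h (t x) \<partial>M)"
proof -
  obtain A where A: "linear A" "surj A" "\<And>x y. ip x y = x \<bullet> A y"
    using is_inner_product_eq_inner[OF is_inner_product] by blast
  define T where "T x = A (t x)" for x
  have "A \<in> borel_measurable borel"
    using linear_continuous_on[OF A(1)[unfolded linear_conv_bounded_linear]]
    by (rule borel_measurable_continuous_onI)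
  then have T: "T \<in> borel_measurable M"
    unfolding T_def by measurable
  have p: "p = (\<lambda>\<theta> x. exp (\<theta> \<bullet> T x))"
    by (simp add: fun_eq_iff unnormalized_density_def A T_def)
  have "\<Theta> = {\<theta>. integrable M (\<lambda>x. exp (\<theta> \<bullet> T x))}"
    using mem_natural_parameter_space_iff by (auto simp: p)
  then have \<theta>: "\<theta> \<in> interior {\<theta>. integrable M (\<lambda>x. exp (\<theta> \<bullet> T x))}"
    using assms open_natural_parameter_space by (simp add: interior_open)
  have i: "integrable M (\<lambda>x. exp (\<theta> \<bullet> T x) *\<^sub>R T x)"
    by (rule integrable_exp_inner_scaleR[OF T \<theta>])
  then have "integrable M (\<lambda>x. h \<bullet> (exp (\<theta> \<bullet> T x) *\<^sub>R T x))"
    by (rule integrable_inner_right)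
  then show "integrable M (\<lambda>x. p \<theta> x * ip h (t x))"
    by (simp add: p A(3) T_def)
  define G where "G = (\<integral>x. exp (\<theta> \<bullet> T x) *\<^sub>R T x \<partial>M)"
  \<comment> \<open>\<open>G\<close> is the Euclidean gradient; by symmetry of \<open>ip\<close>,
    its preimage \<open>g\<close> under \<open>A\<close> represents the same derivative through
    \<open>ip\<close>.\<close>
  obtain g where g: "G = A g"
    using A(2) by (meson surjD)
  have "ip g = (\<lambda>h. h \<bullet> G)"
    using is_inner_product A(3) g by (metis is_inner_product_def)
  then have "((\<lambda>\<theta>. real_of_ereal (Z \<theta>)) has_derivative ip g) (at \<theta>)"
    using has_derivative_integral_exp_inner[OF T \<theta>]
    by (simp add: real_of_partition_function p G_def)
  then have "gradient ip (\<lambda>\<theta>. real_of_ereal (Z \<theta>)) \<theta> = g"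
    by (rule gradient_eq[OF is_inner_product])
  then have "ip h (gradient ip (\<lambda>\<theta>. real_of_ereal (Z \<theta>)) \<theta>) = h \<bullet> G"
    by (simp add: A(3) g)
  also have "\<dots> = (\<integral>x. p \<theta> x * ip h (t x) \<partial>M)"
    unfolding G_def integral_inner_right[OF i, symmetric] by (simp add: p A(3) T_def)
  finally show "ip h (gradient ip (\<lambda>\<theta>. real_of_ereal (Z \<theta>)) \<theta>) = (\<integral>x. p \<theta> x * ip h (t x) \<partial>M)" .
qed

section \<open>Identities between the divergences\<close>

text \<open>The logarithm contributes a linear functional of \<open>t\<close> weighted by the first
  density, so its integral is a directional derivative of \<open>Z\<close> at
  \<open>\<theta>1\<close>. The base point of the Bregman divergence is therefore
  \<open>\<theta>1\<close>, whence the swapped order.\<close>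

lemma KL_div_eq_bregman_div:
  assumes "\<theta>1 \<in> \<Theta>" "\<theta>2 \<in> \<Theta>"
  shows "KL_div M (p \<theta>1) (p \<theta>2) = bregman_div ip Z \<theta>2 \<theta>1"
proof -
  have i: "integrable M (p \<theta>1)" "integrable M (p \<theta>2)"
    "integrable M (\<lambda>x. p \<theta>1 x * ip (\<theta>2 - \<theta>1) (t x))"
    using assms integrable_ip_density by (auto simp: mem_natural_parameter_space_iff)
  have "p \<theta>1 x * ln (p \<theta>1 x / p \<theta>2 x) + p \<theta>2 x - p \<theta>1 x
      = p \<theta>2 x - p \<theta>1 x - p \<theta>1 x * ip (\<theta>2 - \<theta>1) (t x)" for x
    by (simp add: linear_diff[OF ip_linear(1)] unnormalized_density_def algebra_simps flip: exp_diff)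
  then have "KL_div M (p \<theta>1) (p \<theta>2)
      = ereal (\<integral>x. p \<theta>2 x - p \<theta>1 x - p \<theta>1 x * ip (\<theta>2 - \<theta>1) (t x) \<partial>M)"
    unfolding KL_div_def using i by (simp add: ext_integral_eq_integral)
  also have "\<dots> = bregman_div ip Z \<theta>2 \<theta>1"
    using assms i
    by (simp add: bregman_div_def partition_function_eq ip_gradient_partition_function)
  finally show ?thesis .
qed

lemma density_powr_mult:
  "p \<theta>1 x powr a * p \<theta>2 x powr b = p (a *\<^sub>R \<theta>1 + b *\<^sub>R \<theta>2) x"
  by (simp add: unnormalized_density_def linear_add[OF ip_linear(1)] linear_scale[OF ip_linear(1)]
      exp_powr_real exp_add mult.commute)

lemma ext_integral_eq_skew_jensen_div:
  assumes "\<theta>1 \<in> \<Theta>" "\<theta>2 \<in> \<Theta>"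
  shows "ext_integral M
      (\<lambda>x. \<alpha> * p \<theta>1 x + (1 - \<alpha>) * p \<theta>2 x - p \<theta>1 x powr \<alpha> * p \<theta>2 x powr (1 - \<alpha>))
    = skew_jensen_div Z \<alpha> \<theta>1 \<theta>2"
proof -
  have i: "integrable M (p \<theta>1)" "integrable M (p \<theta>2)"
    using assms by (simp_all add: mem_natural_parameter_space_iff)
  define \<theta> where "\<theta> = \<alpha> *\<^sub>R \<theta>1 + (1 - \<alpha>) *\<^sub>R \<theta>2"
  show ?thesis
  proof (cases "\<theta> \<in> \<Theta>")
    case True
    then have "integrable M (p \<theta>)"
      by (simp add: mem_natural_parameter_space_iff)
    then show ?thesis
      using i True assms unfolding density_powr_mult skew_jensen_div_def \<theta>_def[symmetric]
      by (simp add: ext_integral_eq_integral partition_function_eq)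
  next
    case False
    \<comment> \<open>The first two terms are integrable while \<open>p \<theta>\<close> has
      infinite integral. The Jensen side is likewise a finite value minus
      \<open>Z \<theta> = \<infinity>\<close>.\<close>
    have "ext_integral M (\<lambda>x. \<alpha> * p \<theta>1 x + (1 - \<alpha>) * p \<theta>2 x - p \<theta> x) = - \<infinity>"
      using i partition_function_eq_PInf(2)[OF False] less_imp_le[OF density_pos]
      by (intro ext_integral_diff_eq_MInf) auto
    then show ?thesis
      using assms False unfolding density_powr_mult skew_jensen_div_def \<theta>_def[symmetric]
      by (simp add: partition_function_eq partition_function_eq_PInf(1))
  qed
qed

end

theorem proposition5:
  fixes M :: "'x measure"
    and ip :: "real ^ 'm \<Rightarrow> real ^ 'm \<Rightarrow> real"
    and t :: "'x \<Rightarrow> real ^ 'm"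
  assumes "regular_exponential_family M ip t"
  shows "(\<forall>\<theta>1 \<in> natural_parameter_space M ip t. \<forall>\<theta>2 \<in> natural_parameter_space M ip t. \<forall>\<alpha>.
            alpha_div M \<alpha> (unnormalized_density ip t \<theta>1) (unnormalized_density ip t \<theta>2)
            = scaled_skew_jensen_div ip (partition_function M ip t) \<alpha> \<theta>1 \<theta>2)
       \<and> (\<forall>\<theta>1 \<in> natural_parameter_space M ip t. \<forall>\<theta>2 \<in> natural_parameter_space M ip t.
            KL_div M (unnormalized_density ip t \<theta>1) (unnormalized_density ip t \<theta>2)
            = bregman_div ip (partition_function M ip t) \<theta>2 \<theta>1)"
proof -
  interpret regular_family M ip t
    using assms by unfold_locales
  show ?thesis
    \<comment> \<open>For \<open>\<alpha>\<close> other than \<open>0\<close> and \<open>1\<close>,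
      both sides carry the same scalar, so equality of the unscaled extended reals suffices,
      including the value \<open>- \<infinity>\<close>.\<close>
    by (simp add: alpha_div_def scaled_skew_jensen_div_def KL_div_eq_bregman_div
        ext_integral_eq_skew_jensen_div)
qed

end
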